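(* Let $(\mathcal{A},\mathcal{E})$ be an AIS-category. Let $X$, $Y'$ and $Y''$ be three $\mathcal{E}$-subobjects of an object $Z$, with an admissible monic $Y'\to Y''$ compatible with the admissible monics $Y'\to Z$ and $Y''\to Z$. Then there exists an admissible short exact sequence $$(Y'+_Z X)/X \rightarrowtail (Y''+_Z X)/X \twoheadrightarrow (Y''+_Z X)/(Y'+_Z X).$$
   Context: In an exact category $(\mathcal{A},\mathcal{E})$ (additive category with a Quillen exact structure), the pairs $(i,d)\in\mathcal{E}$ are called admissible short exact sequences, $i$ is called an admissible monic ($\rightarrowtail$) and $d$ an admissible epic ($\twoheadrightarrow$). An $\mathcal{E}$-subobject of $Z$ is an object $A$ together with an admissible monic $A\to Z$. For an admissible monic $i:A\to B$, $B/A$ denotes the cokernel of $i$. An exact category $(\mathcal{A},\mathcal{E})$ is an AIS-category if it satisfies the axiom (AIS): for any two admissible monics $j:C\to D$ and $g:B\to D$, their pull-back $A$ exists and yields two admissible monics $i:A\to B$ and $f:A\to C$ (with $g\circ i=j\circ f$); and moreover, if $E$ is the push-out of $i$ and $f$, with morphisms $l:B\to E$ and $k:C\to E$, then the unique morphism $u:E\to D$ with $u\circ l=g$ and $u\circ k=j$ is an admissible monic. For two $\mathcal{E}$-subobjects $(X_1,i_1)$, $(X_2,i_2)$ of $Z$, the intersection $X_1\cap_Z X_2$ is the pull-back of $i_1$ and $i_2$, and the sum $X_1+_Z X_2$ is the push-out of the two projections $X_1\cap_Z X_2\to X_1$, $X_1\cap_Z X_2\to X_2$; by (AIS) it is an $\mathcal{E}$-subobject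 of $Z$. The quotients in the claim are taken along the canonical admissible monics $X\to Y'+_Z X$, $X\to Y''+_Z X$ (push-out morphisms) and $Y'+_Z X\to Y''+_Z X$ (the morphism induced by $Y'\to Y''$ and $1_X$, compatible with the monics into $Z$). *)

theory Defs
  imports Main "HOL-Algebra.Group"
begin

section \<open>Categories with additive structure on the morphism sets\<close>

text \<open>Composition is written in the usual order: \<open>g \<cdot> f\<close> is \<open>g\<close> after \<open>f\<close>. The operations of
  the record are meaningful only on composable, respectively parallel, arrows.\<close>

record ('o, 'm) preadditive =
  Obj :: "'o set"
  Arr :: "'m set"
  Dom :: "'m \<Rightarrow> 'o"
  Cod :: "'m \<Rightarrow> 'o"
  Idn :: "'o \<Rightarrow> 'm"
  Comp :: "'m \<Rightarrow> 'm \<Rightarrow> 'm" (infixl "\<cdot>\<index>" 70)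
  Add :: "'m \<Rightarrow> 'm \<Rightarrow> 'm" (infixl "\<boxplus>\<index>" 65)
  Zer :: "'o \<Rightarrow> 'o \<Rightarrow> 'm"

definition Hom :: "('o, 'm, 'x) preadditive_scheme \<Rightarrow> 'o \<Rightarrow> 'o \<Rightarrow> 'm set" where
  "Hom C a b = {f \<in> Arr C. Dom C f = a \<and> Cod C f = b}"

definition Hom_group :: "('o, 'm, 'x) preadditive_scheme \<Rightarrow> 'o \<Rightarrow> 'o \<Rightarrow> 'm monoid" where
  "Hom_group C a b = \<lparr>carrier = Hom C a b, mult = Add C, one = Zer C a b\<rparr>"

definition zero_object :: "('o, 'm, 'x) preadditive_scheme \<Rightarrow> 'o \<Rightarrow> bool" where
  "zero_object C z \<longleftrightarrow> z \<in> Obj C \<and>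
     (\<forall>a \<in> Obj C. (\<exists>!f. f \<in> Hom C a z) \<and> (\<exists>!f. f \<in> Hom C z a))"

definition biproduct ::
  "('o, 'm, 'x) preadditive_scheme \<Rightarrow> 'o \<Rightarrow> 'o \<Rightarrow> 'o \<Rightarrow> 'm \<Rightarrow> 'm \<Rightarrow> 'm \<Rightarrow> 'm \<Rightarrow> bool" where
  "biproduct C a b s i1 i2 p1 p2 \<longleftrightarrow>
     i1 \<in> Hom C a s \<and> i2 \<in> Hom C b s \<and> p1 \<in> Hom C s a \<and> p2 \<in> Hom C s b \<and>
     p1 \<cdot>\<^bsub>C\<^esub> i1 = Idn C a \<and> p2 \<cdot>\<^bsub>C\<^esub> i2 = Idn C b \<and>
     p1 \<cdot>\<^bsub>C\<^esub> i2 = Zer C b a \<and> p2 \<cdot>\<^bsub>C\<^esub> i1 = Zer C a b \<and>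
     (i1 \<cdot>\<^bsub>C\<^esub> p1) \<boxplus>\<^bsub>C\<^esub> (i2 \<cdot>\<^bsub>C\<^esub> p2) = Idn C s"

locale additive_category =
  fixes C :: "('o, 'm, 'x) preadditive_scheme" (structure)
  assumes dom_obj: "f \<in> Arr C \<Longrightarrow> Dom C f \<in> Obj C"
    and cod_obj: "f \<in> Arr C \<Longrightarrow> Cod C f \<in> Obj C"
    and idn_hom: "a \<in> Obj C \<Longrightarrow> Idn C a \<in> Hom C a a"
    and comp_hom: "\<lbrakk>f \<in> Hom C a b; g \<in> Hom C b c\<rbrakk> \<Longrightarrow> g \<cdot> f \<in> Hom C a c"
    and idn_left: "f \<in> Hom C a b \<Longrightarrow> Idn C b \<cdot> f = f"
    and idn_right: "f \<in> Hom C a b \<Longrightarrow> f \<cdot> Idn C a = f"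
    and comp_assoc: "\<lbrakk>f \<in> Hom C a b; g \<in> Hom C b c; h \<in> Hom C c d\<rbrakk>
          \<Longrightarrow> (h \<cdot> g) \<cdot> f = h \<cdot> (g \<cdot> f)"
    and hom_comm_group: "\<lbrakk>a \<in> Obj C; b \<in> Obj C\<rbrakk> \<Longrightarrow> comm_group (Hom_group C a b)"
    and comp_add_right: "\<lbrakk>f \<in> Hom C a b; g \<in> Hom C a b; h \<in> Hom C b c\<rbrakk>
          \<Longrightarrow> h \<cdot> (f \<boxplus> g) = (h \<cdot> f) \<boxplus> (h \<cdot> g)"
    and comp_add_left: "\<lbrakk>h \<in> Hom C a b; f \<in> Hom C b c; g \<in> Hom C b c\<rbrakk>
          \<Longrightarrow> (f \<boxplus> g) \<cdot> h = (f \<cdot> h) \<boxplus> (g \<cdot> h)"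
    and ex_zero_object: "\<exists>z. zero_object C z"
    and ex_biproduct: "\<lbrakk>a \<in> Obj C; b \<in> Obj C\<rbrakk>
          \<Longrightarrow> \<exists>s i1 i2 p1 p2. biproduct C a b s i1 i2 p1 p2"

section \<open>Pull-backs, push-outs, kernels and cokernels\<close>

definition isomorphism :: "('o, 'm, 'x) preadditive_scheme \<Rightarrow> 'm \<Rightarrow> bool" where
  "isomorphism C f \<longleftrightarrow> f \<in> Arr C \<and>
     (\<exists>g \<in> Hom C (Cod C f) (Dom C f).
        g \<cdot>\<^bsub>C\<^esub> f = Idn C (Dom C f) \<and> f \<cdot>\<^bsub>C\<^esub> g = Idn C (Cod C f))"

text \<open>In the three predicates below the arguments are arranged as
  \<open>p : A \<rightarrow> B\<close>, \<open>q : A \<rightarrow> B'\<close>, \<open>f : B \<rightarrow> D\<close>, \<open>g : B' \<rightarrow> D\<close> with \<open>f \<cdot> p = g \<cdot> q\<close>.\<close>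

definition comm_square :: "('o, 'm, 'x) preadditive_scheme \<Rightarrow> 'm \<Rightarrow> 'm \<Rightarrow> 'm \<Rightarrow> 'm \<Rightarrow> bool" where
  "comm_square C p q f g \<longleftrightarrow>
     p \<in> Arr C \<and> q \<in> Arr C \<and> f \<in> Arr C \<and> g \<in> Arr C \<and>
     Dom C p = Dom C q \<and> Cod C p = Dom C f \<and> Cod C q = Dom C g \<and> Cod C f = Cod C g \<and>
     f \<cdot>\<^bsub>C\<^esub> p = g \<cdot>\<^bsub>C\<^esub> q"

definition pullback :: "('o, 'm, 'x) preadditive_scheme \<Rightarrow> 'm \<Rightarrow> 'm \<Rightarrow> 'm \<Rightarrow> 'm \<Rightarrow> bool" where
  "pullback C p q f g \<longleftrightarrow> comm_square C p q f g \<and>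
     (\<forall>r s. comm_square C r s f g \<longrightarrow>
        (\<exists>!u. u \<in> Hom C (Dom C r) (Dom C p) \<and> p \<cdot>\<^bsub>C\<^esub> u = r \<and> q \<cdot>\<^bsub>C\<^esub> u = s))"

definition pushout :: "('o, 'm, 'x) preadditive_scheme \<Rightarrow> 'm \<Rightarrow> 'm \<Rightarrow> 'm \<Rightarrow> 'm \<Rightarrow> bool" where
  "pushout C p q f g \<longleftrightarrow> comm_square C p q f g \<and>
     (\<forall>r s. comm_square C p q r s \<longrightarrow>
        (\<exists>!u. u \<in> Hom C (Cod C f) (Cod C r) \<and> u \<cdot>\<^bsub>C\<^esub> f = r \<and> u \<cdot>\<^bsub>C\<^esub> g = s))"

definition is_kernel :: "('o, 'm, 'x) preadditive_scheme \<Rightarrow> 'm \<Rightarrow> 'm \<Rightarrow> bool" where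
  "is_kernel C i d \<longleftrightarrow> i \<in> Arr C \<and> d \<in> Arr C \<and> Cod C i = Dom C d \<and>
     d \<cdot>\<^bsub>C\<^esub> i = Zer C (Dom C i) (Cod C d) \<and>
     (\<forall>h \<in> Arr C. Cod C h = Dom C d \<and> d \<cdot>\<^bsub>C\<^esub> h = Zer C (Dom C h) (Cod C d) \<longrightarrow>
        (\<exists>!u. u \<in> Hom C (Dom C h) (Dom C i) \<and> i \<cdot>\<^bsub>C\<^esub> u = h))"

definition is_cokernel :: "('o, 'm, 'x) preadditive_scheme \<Rightarrow> 'm \<Rightarrow> 'm \<Rightarrow> bool" where
  "is_cokernel C d i \<longleftrightarrow> i \<in> Arr C \<and> d \<in> Arr C \<and> Cod C i = Dom C d \<and>
     d \<cdot>\<^bsub>C\<^esub> i = Zer C (Dom C i) (Cod C d) \<and>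
     (\<forall>h \<in> Arr C. Dom C h = Cod C i \<and> h \<cdot>\<^bsub>C\<^esub> i = Zer C (Dom C i) (Cod C h) \<longrightarrow>
        (\<exists>!u. u \<in> Hom C (Cod C d) (Cod C h) \<and> u \<cdot>\<^bsub>C\<^esub> d = h))"

section \<open>Exact categories and AIS-categories\<close>

definition kernel_cokernel_pair :: "('o, 'm, 'x) preadditive_scheme \<Rightarrow> 'm \<times> 'm \<Rightarrow> bool" where
  "kernel_cokernel_pair C = (\<lambda>(i, d). is_kernel C i d \<and> is_cokernel C d i)"

definition pair_iso :: "('o, 'm, 'x) preadditive_scheme \<Rightarrow> 'm \<times> 'm \<Rightarrow> 'm \<times> 'm \<Rightarrow> bool" where
  "pair_iso C = (\<lambda>(i, d) (i', d'). \<exists>a b c.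
     isomorphism C a \<and> isomorphism C b \<and> isomorphism C c \<and>
     comm_square C i a b i' \<and> comm_square C d b c d')"

definition admissible_monic :: "('m \<times> 'm) set \<Rightarrow> 'm \<Rightarrow> bool" where
  "admissible_monic E i \<longleftrightarrow> (\<exists>d. (i, d) \<in> E)"

definition admissible_epic :: "('m \<times> 'm) set \<Rightarrow> 'm \<Rightarrow> bool" where
  "admissible_epic E d \<longleftrightarrow> (\<exists>i. (i, d) \<in> E)"

locale exact_category = additive_category C
  for C :: "('o, 'm, 'x) preadditive_scheme" (structure) +
  fixes E :: "('m \<times> 'm) set"
  assumes ker_coker: "e \<in> E \<Longrightarrow> kernel_cokernel_pair C e"
    and iso_closed: "\<lbrakk>e \<in> E; kernel_cokernel_pair C e'; pair_iso C e e'\<rbrakk> \<Longrightarrow> e' \<in> E"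
    and id_monic: "a \<in> Obj C \<Longrightarrow> admissible_monic E (Idn C a)"
    and id_epic: "a \<in> Obj C \<Longrightarrow> admissible_epic E (Idn C a)"
    and comp_monic: "\<lbrakk>admissible_monic E f; admissible_monic E g; Cod C f = Dom C g\<rbrakk>
          \<Longrightarrow> admissible_monic E (g \<cdot> f)"
    and comp_epic: "\<lbrakk>admissible_epic E f; admissible_epic E g; Cod C f = Dom C g\<rbrakk>
          \<Longrightarrow> admissible_epic E (g \<cdot> f)"
    and pushout_ex: "\<lbrakk>admissible_monic E i; t \<in> Arr C; Dom C t = Dom C i\<rbrakk>
          \<Longrightarrow> \<exists>t' i'. pushout C i t t' i'"
    and pushout_monic: "\<lbrakk>admissible_monic E i; pushout C i t t' i'\<rbrakk> \<Longrightarrow> admissible_monic E i'"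
    and pullback_ex: "\<lbrakk>admissible_epic E d; t \<in> Arr C; Cod C t = Cod C d\<rbrakk>
          \<Longrightarrow> \<exists>t' d'. pullback C t' d' d t"
    and pullback_epic: "\<lbrakk>admissible_epic E d; pullback C t' d' d t\<rbrakk> \<Longrightarrow> admissible_epic E d'"

locale AIS_category = exact_category C E
  for C :: "('o, 'm, 'x) preadditive_scheme" (structure) and E :: "('m \<times> 'm) set" +
  assumes AIS_pullback_ex: "\<lbrakk>admissible_monic E j; admissible_monic E g; Cod C j = Cod C g\<rbrakk>
          \<Longrightarrow> \<exists>i f. pullback C i f g j"
    and AIS_pullback_monic: "\<lbrakk>admissible_monic E j; admissible_monic E g; pullback C i f g j\<rbrakk>
          \<Longrightarrow> admissible_monic E i \<and> admissible_monic E f"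
    and AIS_sum_monic: "\<lbrakk>admissible_monic E j; admissible_monic E g; pullback C i f g j;
            pushout C i f l k; u \<in> Hom C (Cod C l) (Cod C g); u \<cdot> l = g; u \<cdot> k = j\<rbrakk>
          \<Longrightarrow> admissible_monic E u"

section \<open>Subobjects, sums and quotients\<close>

definition subobject ::
  "('o, 'm, 'x) preadditive_scheme \<Rightarrow> ('m \<times> 'm) set \<Rightarrow> 'o \<Rightarrow> 'o \<Rightarrow> 'm \<Rightarrow> bool" where
  "subobject C E Z X i \<longleftrightarrow> i \<in> Hom C X Z \<and> admissible_monic E i"

text \<open>Intersections, sums and quotients are determined only up to isomorphism, so they are
  relations: \<open>S\<close>, together with \<open>k1 : X1 \<rightarrow> S\<close> and \<open>k2 : X2 \<rightarrow> S\<close>, is a sum of the subobjects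
  \<open>i1 : X1 \<rightarrow> Z\<close> and \<open>i2 : X2 \<rightarrow> Z\<close>. Choosing another pull-back \<open>P\<close> does not
  change the push-outs.\<close>

definition is_intersection ::
  "('o, 'm, 'x) preadditive_scheme \<Rightarrow> 'm \<Rightarrow> 'm \<Rightarrow> 'o \<Rightarrow> 'm \<Rightarrow> 'm \<Rightarrow> bool" where
  "is_intersection C i1 i2 P p1 p2 \<longleftrightarrow> pullback C p1 p2 i1 i2 \<and> Dom C p1 = P"

definition is_sum ::
  "('o, 'm, 'x) preadditive_scheme \<Rightarrow> 'm \<Rightarrow> 'm \<Rightarrow> 'o \<Rightarrow> 'm \<Rightarrow> 'm \<Rightarrow> bool" where
  "is_sum C i1 i2 S k1 k2 \<longleftrightarrow>
     (\<exists>P p1 p2. is_intersection C i1 i2 P p1 p2 \<and> pushout C p1 p2 k1 k2) \<and> Cod C k1 = S"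

definition is_quotient :: "('o, 'm, 'x) preadditive_scheme \<Rightarrow> 'm \<Rightarrow> 'o \<Rightarrow> 'm \<Rightarrow> bool" where
  "is_quotient C i Q q \<longleftrightarrow> is_cokernel C q i \<and> Cod C q = Q"

section \<open>Existence and admissibility of the canonical morphisms\<close>

lemma comm_squareI:
  assumes "p \<in> Hom C a b" "q \<in> Hom C a b'" "f \<in> Hom C b d" "g \<in> Hom C b' d"
    and "f \<cdot>\<^bsub>C\<^esub> p = g \<cdot>\<^bsub>C\<^esub> q"
  shows "comm_square C p q f g"
  using assms by (simp add: comm_square_def Hom_def)

lemma comm_squareD:
  assumes "comm_square C p q f g"
  shows "p \<in> Hom C (Dom C p) (Dom C f)" "q \<in> Hom C (Dom C p) (Dom C g)"
    "f \<in> Hom C (Dom C f) (Cod C f)" "g \<in> Hom C (Dom C g) (Cod C f)" "f \<cdot>\<^bsub>C\<^esub> p = g \<cdot>\<^bsub>C\<^esub> q"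
  using assms by (simp_all add: comm_square_def Hom_def)

lemma pullback_square: "pullback C p q f g \<Longrightarrow> comm_square C p q f g"
  by (simp add: pullback_def)

lemma pushout_square: "pushout C p q f g \<Longrightarrow> comm_square C p q f g"
  by (simp add: pushout_def)

lemma comm_square_swap: "comm_square C p q f g \<longleftrightarrow> comm_square C q p g f"
  unfolding comm_square_def by auto

lemma pushout_swap:
  assumes "pushout C p q f g"
  shows "pushout C q p g f"
proof -
  have sq: "comm_square C p q f g"
    using assms by (simp add: pushout_def)
  have "\<exists>!u. u \<in> Hom C (Cod C g) (Cod C r) \<and> u \<cdot>\<^bsub>C\<^esub> g = r \<and> u \<cdot>\<^bsub>C\<^esub> f = s"
    if "comm_square C q p r s" for r s
  proof -
    have "comm_square C p q s r"
      using that comm_square_swap by metis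
    then have "\<exists>!u. u \<in> Hom C (Cod C f) (Cod C s) \<and> u \<cdot>\<^bsub>C\<^esub> f = s \<and> u \<cdot>\<^bsub>C\<^esub> g = r"
      using assms by (simp add: pushout_def)
    moreover have "Cod C f = Cod C g" "Cod C s = Cod C r"
      using sq that by (simp_all add: comm_square_def)
    ultimately show ?thesis
      by (simp add: conj_commute)
  qed
  then show ?thesis
    using sq comm_square_swap[of C p q f g] unfolding pushout_def by blast
qed

context additive_category
begin

lemma Hom_obj:
  assumes "f \<in> Hom C a b" shows "a \<in> Obj C" "b \<in> Obj C"
  using assms dom_obj cod_obj by (auto simp: Hom_def)

lemma zer_comp:
  assumes f: "f \<in> Hom C a b" and c: "c \<in> Obj C"
  shows "Zer C b c \<cdot> f = Zer C a c"
proof -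
  note ob = Hom_obj[OF f]
  interpret B: comm_group "Hom_group C b c" using hom_comm_group ob c by blast
  interpret A: comm_group "Hom_group C a c" using hom_comm_group ob c by blast
  have z: "Zer C b c \<in> Hom C b c" "Zer C b c \<boxplus> Zer C b c = Zer C b c"
    using B.one_closed B.l_one[OF B.one_closed] by (simp_all add: Hom_group_def)
  have w: "Zer C b c \<cdot> f \<in> carrier (Hom_group C a c)"
    using comp_hom[OF f z(1)] by (simp add: Hom_group_def)
  have "(Zer C b c \<cdot> f) \<boxplus> (Zer C b c \<cdot> f) = Zer C b c \<cdot> f"
    using comp_add_left[OF f z(1) z(1)] z(2) by simp
  then have "(Zer C b c \<cdot> f) \<otimes>\<^bsub>Hom_group C a c\<^esub> (Zer C b c \<cdot> f) = Zer C b c \<cdot> f"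
    by (simp add: Hom_group_def)
  then show ?thesis
    using A.l_cancel_one[OF w w] by (simp add: Hom_group_def)
qed

end

context exact_category
begin

lemma admissible_monic_arr: "admissible_monic E i \<Longrightarrow> i \<in> Hom C (Dom C i) (Cod C i)"
  using ker_coker by (fastforce simp: admissible_monic_def kernel_cokernel_pair_def is_kernel_def Hom_def)

lemma quotient_exists:
  assumes "admissible_monic E i" shows "\<exists>Q q. is_quotient C i Q q"
  using assms ker_coker by (fastforce simp: admissible_monic_def kernel_cokernel_pair_def is_quotient_def)

lemma admissible_monic_cancel:
  assumes i: "admissible_monic E i" "i \<in> Hom C b c"
    and uv: "u \<in> Hom C a b" "v \<in> Hom C a b" "i \<cdot> u = i \<cdot> v"
  shows "u = v"
proof -
  obtain d where d: "is_kernel C i d"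
    using i ker_coker by (fastforce simp: admissible_monic_def kernel_cokernel_pair_def)
  have dH: "d \<in> Hom C c (Cod C d)" and z: "d \<cdot> i = Zer C b (Cod C d)"
    using d i by (auto simp: is_kernel_def Hom_def)
  have iu: "i \<cdot> u \<in> Hom C a c"
    using comp_hom uv i by blast
  have "d \<cdot> (i \<cdot> u) = Zer C a (Cod C d)"
    using comp_assoc[OF uv(1) i(2) dH] z zer_comp[OF uv(1)] Hom_obj[OF dH] by simp
  then have "\<exists>!w. w \<in> Hom C (Dom C (i \<cdot> u)) (Dom C i) \<and> i \<cdot> w = i \<cdot> u"
    using d[unfolded is_kernel_def, THEN conjunct2, THEN conjunct2, THEN conjunct2, THEN conjunct2,
        rule_format, of "i \<cdot> u"] iu dH by (simp add: Hom_def)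
  then have "\<exists>!w. w \<in> Hom C a b \<and> i \<cdot> w = i \<cdot> u"
    using iu i(2) by (simp add: Hom_def)
  then show ?thesis
    using uv by metis
qed

end

context AIS_category
begin

lemma sum_exists:
  assumes "subobject C E Z X1 i1" "subobject C E Z X2 i2"
  shows "\<exists>S k1 k2. is_sum C i1 i2 S k1 k2"
proof -
  have a: "admissible_monic E i1" "admissible_monic E i2" "Cod C i1 = Cod C i2"
    using assms by (auto simp: subobject_def Hom_def)
  obtain p1 p2 where p: "pullback C p1 p2 i1 i2"
    using AIS_pullback_ex[OF a(2,1)] a(3) by auto
  then have "admissible_monic E p1" "p2 \<in> Arr C" "Dom C p2 = Dom C p1"
    using AIS_pullback_monic[OF a(2,1) p] pullback_square[OF p] by (auto simp: comm_square_def)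
  then show ?thesis
    using pushout_ex[of p1 p2] p unfolding is_sum_def is_intersection_def by blast
qed

lemma sum_inclusions_admissible:
  assumes "subobject C E Z X1 i1" "subobject C E Z X2 i2" "is_sum C i1 i2 S k1 k2"
  shows "k1 \<in> Hom C X1 S" "k2 \<in> Hom C X2 S" "admissible_monic E k1" "admissible_monic E k2"
proof -
  obtain p1 p2 where p: "pullback C p1 p2 i1 i2" "pushout C p1 p2 k1 k2"
    using assms by (auto simp: is_sum_def is_intersection_def)
  have "admissible_monic E p1" "admissible_monic E p2"
    using AIS_pullback_monic[of i2 i1 p1 p2] p assms by (auto simp: subobject_def)
  then show "admissible_monic E k1" "admissible_monic E k2"
    using pushout_monic p(2) pushout_swap[OF p(2)] by blast+
  show "k1 \<in> Hom C X1 S" "k2 \<in> Hom C X2 S"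
    using pullback_square[OF p(1)] pushout_square[OF p(2)] assms
    by (auto simp: comm_square_def subobject_def Hom_def is_sum_def)
qed

lemma sum_subobject:
  assumes "subobject C E Z X1 i1" "subobject C E Z X2 i2" "is_sum C i1 i2 S k1 k2"
  shows "\<exists>!u. u \<in> Hom C S Z \<and> u \<cdot> k1 = i1 \<and> u \<cdot> k2 = i2"
    and "\<lbrakk>u \<in> Hom C S Z; u \<cdot> k1 = i1; u \<cdot> k2 = i2\<rbrakk> \<Longrightarrow> subobject C E Z S u"
proof -
  obtain p1 p2 where p: "pullback C p1 p2 i1 i2" "pushout C p1 p2 k1 k2" "Cod C k1 = S"
    using assms by (auto simp: is_sum_def is_intersection_def)
  have cod: "Cod C i1 = Z"
    using assms by (simp add: subobject_def Hom_def)
  show "\<exists>!u. u \<in> Hom C S Z \<and> u \<cdot> k1 = i1 \<and> u \<cdot> k2 = i2"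
    using p(1,3) cod p(2)[unfolded pushout_def, THEN conjunct2, rule_format, of i1 i2]
    by (simp add: pullback_def)
  show "subobject C E Z S u" if "u \<in> Hom C S Z" "u \<cdot> k1 = i1" "u \<cdot> k2 = i2"
    using AIS_sum_monic[of i2 i1 p1 p2 k1 k2 u] that p cod assms by (auto simp: subobject_def)
qed

lemma sum_map:
  assumes x: "subobject C E Z X x" and y': "subobject C E Z Y' y'" and y'': "subobject C E Z Y'' y''"
    and t: "t \<in> Hom C Y' Y''" "y'' \<cdot> t = y'"
    and s': "is_sum C y' x S' k' l'" and s'': "is_sum C y'' x S'' k'' l''"
  shows "\<exists>!c. c \<in> Hom C S' S'' \<and> c \<cdot> k' = k'' \<cdot> t \<and> c \<cdot> l' = l''"
    and "\<lbrakk>c \<in> Hom C S' S''; c \<cdot> k' = k'' \<cdot> t; c \<cdot> l' = l''\<rbrakk> \<Longrightarrow> admissible_monic E c"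
proof -
  obtain p1 p2 where p: "pullback C p1 p2 y' x" "pushout C p1 p2 k' l'" "Cod C k' = S'"
    using s' by (auto simp: is_sum_def is_intersection_def)
  obtain r1 r2 where r: "pullback C r1 r2 y'' x" "pushout C r1 r2 k'' l''" "Cod C k'' = S''"
    using s'' by (auto simp: is_sum_def is_intersection_def)
  have h: "x \<in> Hom C X Z" "y' \<in> Hom C Y' Z" "y'' \<in> Hom C Y'' Z"
    using x y' y'' by (auto simp: subobject_def)
  define P R where "P = Dom C p1" and "R = Dom C r1"
  have ph: "p1 \<in> Hom C P Y'" "p2 \<in> Hom C P X" "y' \<cdot> p1 = x \<cdot> p2"
    using pullback_square[OF p(1)] h by (auto simp: comm_square_def P_def Hom_def)
  have rh: "r1 \<in> Hom C R Y''" "r2 \<in> Hom C R X" "k'' \<cdot> r1 = l'' \<cdot> r2"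
    using pullback_square[OF r(1)] pushout_square[OF r(2)] h
    by (auto simp: comm_square_def R_def Hom_def)
  note k' = sum_inclusions_admissible[OF y' x s']
  note k'' = sum_inclusions_admissible[OF y'' x s'']
  have tp: "t \<cdot> p1 \<in> Hom C P Y''"
    using comp_hom[OF ph(1) t(1)] .
  have "y'' \<cdot> (t \<cdot> p1) = x \<cdot> p2"
    using comp_assoc[OF ph(1) t(1) h(3)] t(2) ph(3) by simp
  then have "comm_square C (t \<cdot> p1) p2 y'' x"
    using comm_squareI[OF tp ph(2) h(3) h(1)] by simp
  then have "\<exists>!u. u \<in> Hom C (Dom C (t \<cdot> p1)) (Dom C r1) \<and> r1 \<cdot> u = t \<cdot> p1 \<and> r2 \<cdot> u = p2"
    using r(1) by (simp add: pullback_def)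
  moreover have "Dom C (t \<cdot> p1) = P"
    using tp by (simp add: Hom_def)
  ultimately obtain u where u: "u \<in> Hom C P R" "r1 \<cdot> u = t \<cdot> p1" "r2 \<cdot> u = p2"
    unfolding R_def by auto
  have k''t: "k'' \<cdot> t \<in> Hom C Y' S''"
    using comp_hom[OF t(1) k''(1)] .
  have "(k'' \<cdot> t) \<cdot> p1 = l'' \<cdot> p2"
    using comp_assoc[OF ph(1) t(1) k''(1)] comp_assoc[OF u(1) rh(1) k''(1)]
      comp_assoc[OF u(1) rh(2) k''(2)] u rh by simp
  then have "comm_square C p1 p2 (k'' \<cdot> t) l''"
    using comm_squareI[OF ph(1,2) k''t k''(2)] by simp
  then show "\<exists>!c. c \<in> Hom C S' S'' \<and> c \<cdot> k' = k'' \<cdot> t \<and> c \<cdot> l' = l''"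
    using p(3) k''t p(2)[unfolded pushout_def, THEN conjunct2, rule_format, of "k'' \<cdot> t" l'']
    by (simp add: Hom_def)
  assume c: "c \<in> Hom C S' S''" "c \<cdot> k' = k'' \<cdot> t" "c \<cdot> l' = l''"
  obtain w where w: "w \<in> Hom C S'' Z" "w \<cdot> k'' = y''" "w \<cdot> l'' = x" "admissible_monic E w"
    using sum_subobject[OF y'' x s''] unfolding subobject_def by metis
  have wc: "w \<cdot> c \<in> Hom C S' Z" "(w \<cdot> c) \<cdot> k' = y'" "(w \<cdot> c) \<cdot> l' = x"
    using comp_hom c w comp_assoc[OF k'(1) c(1) w(1)] comp_assoc[OF k'(2) c(1) w(1)]
      comp_assoc[OF t(1) k''(1) w(1)] t by auto
  then have wcm: "admissible_monic E (w \<cdot> c)"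
    using sum_subobject(2)[OF y' x s'] by (simp add: subobject_def)
  have id: "Idn C S' \<in> Hom C S' S'"
    using idn_hom Hom_obj c by blast
  have "pullback C c (Idn C S') w (w \<cdot> c)"
    unfolding pullback_def
  proof (intro conjI allI impI)
    show "comm_square C c (Idn C S') w (w \<cdot> c)"
      using comm_squareI[OF c(1) id w(1) wc(1)] idn_right[OF wc(1)] by simp
    fix r s assume sq: "comm_square C r s w (w \<cdot> c)"
    have rs: "r \<in> Hom C (Dom C r) S''" "s \<in> Hom C (Dom C r) S'" "w \<cdot> r = (w \<cdot> c) \<cdot> s"
      using sq w(1) wc(1) by (auto simp: comm_square_def Hom_def)
    have "r = c \<cdot> s"
      using admissible_monic_cancel[OF w(4,1) rs(1) comp_hom[OF rs(2) c(1)]]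
        comp_assoc[OF rs(2) c(1) w(1)] rs(3) by simp
    moreover have "Dom C c = S'"
      using c by (simp add: Hom_def)
    ultimately show "\<exists>!u. u \<in> Hom C (Dom C r) (Dom C c) \<and> c \<cdot> u = r \<and> Idn C S' \<cdot> u = s"
      using rs idn_left by metis
  qed
  then show "admissible_monic E c"
    using AIS_pullback_monic[OF wcm w(4)] by blast
qed

end

end

theory Submission
  imports Defs
begin

text \<open>This is the third isomorphism theorem for \<open>X \<rightarrow> S' \<rightarrow> S''\<close>, where \<open>S' = Y' + X\<close> and
  \<open>S'' = Y'' + X\<close>. The axiom (AIS) enters only through the admissibility of \<open>c : S' \<rightarrow> S''\<close>.
  The map \<open>i : S'/X \<rightarrow> S''/X\<close> induced on cokernels is a push-out of \<open>c\<close> along the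
  quotient map \<open>S' \<rightarrow> S'/X\<close>, hence an admissible monic, and the map induced by
  \<open>S'' \<rightarrow> S''/S'\<close> is a cokernel of \<open>i\<close>.\<close>

context additive_category
begin

text \<open>By additivity \<open>g \<cdot> Zer C a b\<close> is idempotent under addition, and the
  only idempotent of a group is its unit.\<close>

lemma comp_zer:
  assumes g: "g \<in> Hom C b c" and a: "a \<in> Obj C"
  shows "g \<cdot> Zer C a b = Zer C a c"
proof -
  note ob = Hom_obj[OF g]
  interpret B: comm_group "Hom_group C a b" using hom_comm_group ob a by blast
  interpret A: comm_group "Hom_group C a c" using hom_comm_group ob a by blast
  have z: "Zer C a b \<in> Hom C a b" "Zer C a b \<boxplus> Zer C a b = Zer C a b"
    using B.one_closed B.l_one[OF B.one_closed] by (simp_all add: Hom_group_def)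
  have w: "g \<cdot> Zer C a b \<in> carrier (Hom_group C a c)"
    using comp_hom[OF z(1) g] by (simp add: Hom_group_def)
  have "(g \<cdot> Zer C a b) \<boxplus> (g \<cdot> Zer C a b) = g \<cdot> Zer C a b"
    using comp_add_right[OF z(1) z(1) g] z(2) by simp
  then have "(g \<cdot> Zer C a b) \<otimes>\<^bsub>Hom_group C a c\<^esub> (g \<cdot> Zer C a b) = g \<cdot> Zer C a b"
    by (simp add: Hom_group_def)
  then show ?thesis
    using A.l_cancel_one[OF w w] by (simp add: Hom_group_def)
qed

lemma isomorphism_Idn: "a \<in> Obj C \<Longrightarrow> isomorphism C (Idn C a)"
  using idn_hom[of a] idn_left[of "Idn C a" a a] by (auto simp: isomorphism_def Hom_def)

lemma cokernel_hom:
  assumes "is_cokernel C q i" "i \<in> Hom C A B"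
  shows "q \<in> Hom C B (Cod C q)" "q \<cdot> i = Zer C A (Cod C q)"
  using assms by (auto simp: is_cokernel_def Hom_def)

lemma cokernel_factor:
  assumes "is_cokernel C q i" "i \<in> Hom C A B" "h \<in> Hom C B T" "h \<cdot> i = Zer C A T"
  obtains u where "u \<in> Hom C (Cod C q) T" "u \<cdot> q = h"
proof -
  have "\<exists>!u. u \<in> Hom C (Cod C q) (Cod C h) \<and> u \<cdot> q = h"
    using assms(1)[unfolded is_cokernel_def, THEN conjunct2, THEN conjunct2, THEN conjunct2,
        THEN conjunct2, rule_format, of h] assms(2-4) by (simp add: Hom_def)
  then show ?thesis
    using assms(3) that by (auto simp: Hom_def)
qed

text \<open>Cokernels are epic: \<open>v \<cdot> q\<close> vanishes on \<open>i\<close>, so it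
  factors uniquely through \<open>q\<close>, and both \<open>u\<close> and \<open>v\<close> are such
  factors.\<close>

lemma cokernel_cancel:
  assumes q: "is_cokernel C q i"
    and uv: "u \<in> Hom C (Cod C q) T" "v \<in> Hom C (Cod C q) T" "u \<cdot> q = v \<cdot> q"
  shows "u = v"
proof -
  define A B where "A = Dom C i" and "B = Cod C i"
  have i: "i \<in> Hom C A B"
    using q by (auto simp: is_cokernel_def Hom_def A_def B_def)
  note q' = cokernel_hom[OF q i]
  have h: "v \<cdot> q \<in> Hom C B T"
    using comp_hom[OF q'(1) uv(2)] .
  have "(v \<cdot> q) \<cdot> i = Zer C A T"
    using comp_assoc[OF i q'(1) uv(2)] q'(2) comp_zer[OF uv(2) Hom_obj(1)[OF i]] by simp
  then have "\<exists>!w. w \<in> Hom C (Cod C q) T \<and> w \<cdot> q = v \<cdot> q"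
    using q[unfolded is_cokernel_def, THEN conjunct2, THEN conjunct2, THEN conjunct2,
        THEN conjunct2, rule_format, of "v \<cdot> q"] h i by (simp add: Hom_def)
  then show ?thesis
    using uv by metis
qed

text \<open>Unique factorization is split into existence of a factor and right cancellation of
  \<open>q\<close>, so that the two can be checked separately for maps between quotients.\<close>

lemma is_cokernelI:
  assumes i: "i \<in> Hom C A B" and q: "q \<in> Hom C B Q" "q \<cdot> i = Zer C A Q"
    and factor: "\<And>h T. \<lbrakk>h \<in> Hom C B T; h \<cdot> i = Zer C A T\<rbrakk> \<Longrightarrow> \<exists>u \<in> Hom C Q T. u \<cdot> q = h"
    and cancel: "\<And>u v T. \<lbrakk>u \<in> Hom C Q T; v \<in> Hom C Q T; u \<cdot> q = v \<cdot> q\<rbrakk> \<Longrightarrow> u = v"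
  shows "is_cokernel C q i"
  unfolding is_cokernel_def
proof (intro conjI ballI impI)
  fix h assume "h \<in> Arr C" "Dom C h = Cod C i \<and> h \<cdot> i = Zer C (Dom C i) (Cod C h)"
  then have "h \<in> Hom C B (Cod C h)" "h \<cdot> i = Zer C A (Cod C h)"
    using i by (auto simp: Hom_def)
  then show "\<exists>!u. u \<in> Hom C (Cod C q) (Cod C h) \<and> u \<cdot> q = h"
    using factor[of h "Cod C h"] cancel q(1) by (auto simp: Hom_def)
qed (use i q in \<open>auto simp: Hom_def\<close>)

text \<open>Each cokernel factors through the other. Both composites of the factors become
  identities after precomposition with an epic cokernel, hence are identities.\<close>

lemma cokernel_unique:
  assumes d: "is_cokernel C d i" and e: "is_cokernel C e i" and i: "i \<in> Hom C A B"
  obtains a b where "a \<in> Hom C (Cod C e) (Cod C d)" "b \<in> Hom C (Cod C d) (Cod C e)"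
    "a \<cdot> e = d" "b \<cdot> d = e" "isomorphism C a"
proof -
  note d' = cokernel_hom[OF d i] and e' = cokernel_hom[OF e i]
  obtain a where a: "a \<in> Hom C (Cod C e) (Cod C d)" "a \<cdot> e = d"
    using cokernel_factor[OF e i d'] .
  obtain b where b: "b \<in> Hom C (Cod C d) (Cod C e)" "b \<cdot> d = e"
    using cokernel_factor[OF d i e'] .
  have "b \<cdot> a = Idn C (Cod C e)"
    using cokernel_cancel[OF e comp_hom[OF a(1) b(1)] idn_hom] Hom_obj[OF a(1)]
      comp_assoc[OF e'(1) a(1) b(1)] a b idn_left[OF e'(1)] by simp
  moreover have "a \<cdot> b = Idn C (Cod C d)"
    using cokernel_cancel[OF d comp_hom[OF b(1) a(1)] idn_hom] Hom_obj[OF a(1)]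
      comp_assoc[OF d'(1) b(1) a(1)] a b idn_left[OF d'(1)] by simp
  ultimately have "isomorphism C a"
    using a(1) b(1) by (auto simp: isomorphism_def Hom_def)
  then show thesis
    using that a b by blast
qed

text \<open>If \<open>r \<cdot> c = s \<cdot> p\<close>, then \<open>r\<close> kills
  \<open>c \<cdot> l\<close> because \<open>p\<close> kills \<open>l\<close>, so
  \<open>r = u \<cdot> q\<close> for some \<open>u\<close>. That \<open>u \<cdot> i = s\<close> is
  tested after precomposition with the epic \<open>p\<close>; uniqueness holds because
  \<open>q\<close> is epic.\<close>

lemma pushout_induced_on_cokernels:
  assumes l: "l \<in> Hom C X S" and c: "c \<in> Hom C S T"
    and p: "is_cokernel C p l" and q: "is_cokernel C q (c \<cdot> l)"
    and i: "i \<in> Hom C (Cod C p) (Cod C q)" "i \<cdot> p = q \<cdot> c"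
  shows "pushout C c p q i"
proof -
  have cl: "c \<cdot> l \<in> Hom C X T"
    using comp_hom[OF l c] .
  note p' = cokernel_hom[OF p l] and q' = cokernel_hom[OF q cl]
  have "\<exists>!u. u \<in> Hom C (Cod C q) (Cod C r) \<and> u \<cdot> q = r \<and> u \<cdot> i = s"
    if sq: "comm_square C c p r s" for r s
  proof -
    have r: "r \<in> Hom C T (Cod C r)" and s: "s \<in> Hom C (Cod C p) (Cod C r)"
      and rs: "r \<cdot> c = s \<cdot> p"
      using sq c by (auto simp: comm_square_def Hom_def)
    have "r \<cdot> (c \<cdot> l) = s \<cdot> (p \<cdot> l)"
      using comp_assoc[OF l c r] comp_assoc[OF l p'(1) s] rs by simp
    also have "\<dots> = Zer C X (Cod C r)"
      using p'(2) comp_zer[OF s Hom_obj(1)[OF l]] by simp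
    finally obtain u where u: "u \<in> Hom C (Cod C q) (Cod C r)" "u \<cdot> q = r"
      using cokernel_factor[OF q cl r] by blast
    have "(u \<cdot> i) \<cdot> p = s \<cdot> p"
      using comp_assoc[OF p'(1) i(1) u(1)] comp_assoc[OF c q'(1) u(1)] i(2) u(2) rs by simp
    then have "u \<cdot> i = s"
      using cokernel_cancel[OF p comp_hom[OF i(1) u(1)] s] by simp
    then show ?thesis
      using u cokernel_cancel[OF q] by metis
  qed
  then show ?thesis
    using comm_squareI[OF c p'(1) q'(1) i(1)] i(2) unfolding pushout_def by simp
qed

text \<open>If \<open>h\<close> kills \<open>i\<close>, then \<open>h \<cdot> q\<close> kills
  \<open>c\<close>, since \<open>h \<cdot> q \<cdot> c = h \<cdot> i \<cdot> p\<close>; it therefore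
  factors through \<open>r = d \<cdot> q\<close>, and cancelling \<open>q\<close> gives a
  factorization of \<open>h\<close> through \<open>d\<close>. Moreover \<open>d\<close> is epic
  because \<open>d \<cdot> q\<close> is.\<close>

lemma cokernel_induced_on_cokernels:
  assumes l: "l \<in> Hom C X S" and c: "c \<in> Hom C S T"
    and p: "is_cokernel C p l" and q: "is_cokernel C q (c \<cdot> l)" and r: "is_cokernel C r c"
    and i: "i \<in> Hom C (Cod C p) (Cod C q)" "i \<cdot> p = q \<cdot> c"
    and d: "d \<in> Hom C (Cod C q) (Cod C r)" "d \<cdot> q = r"
  shows "is_cokernel C d i"
proof (rule is_cokernelI[OF i(1) d(1)])
  have cl: "c \<cdot> l \<in> Hom C X T"
    using comp_hom[OF l c] .
  note p' = cokernel_hom[OF p l] and q' = cokernel_hom[OF q cl] and r' = cokernel_hom[OF r c]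
  \<comment> \<open>To show that \<open>d \<cdot> i\<close> vanishes, it is compared with the zero
    morphism after precomposition with the epic \<open>p\<close>, where it becomes
    \<open>r \<cdot> c\<close>.\<close>
  have "(d \<cdot> i) \<cdot> p = Zer C S (Cod C r)"
    using comp_assoc[OF p'(1) i(1) d(1)] comp_assoc[OF c q'(1) d(1)] i(2) d(2) r'(2) by simp
  moreover have "Zer C (Cod C p) (Cod C r) \<cdot> p = Zer C S (Cod C r)"
    using zer_comp[OF p'(1)] Hom_obj[OF d(1)] by blast
  \<comment> \<open>\<open>Zer\<close> lies in the right morphism set because it is the unit of the
    group on that set.\<close>
  moreover have "Zer C (Cod C p) (Cod C r) \<in> Hom C (Cod C p) (Cod C r)"
    using comp_zer[OF d(1), of "Cod C p"] hom_comm_group[of "Cod C p" "Cod C r"]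
      Hom_obj[OF d(1)] Hom_obj[OF i(1)] monoid.one_closed[of "Hom_group C (Cod C p) (Cod C r)"]
    by (simp add: Hom_group_def comm_group_def group_def)
  ultimately show "d \<cdot> i = Zer C (Cod C p) (Cod C r)"
    using cokernel_cancel[OF p comp_hom[OF i(1) d(1)]] by simp
  show "\<exists>u \<in> Hom C (Cod C r) V. u \<cdot> d = h"
    if h: "h \<in> Hom C (Cod C q) V" "h \<cdot> i = Zer C (Cod C p) V" for h V
  proof -
    have hq: "h \<cdot> q \<in> Hom C T V"
      using comp_hom[OF q'(1) h(1)] .
    have "(h \<cdot> q) \<cdot> c = (h \<cdot> i) \<cdot> p"
      using comp_assoc[OF c q'(1) h(1)] comp_assoc[OF p'(1) i(1) h(1)] i(2) by simp
    also have "\<dots> = Zer C S V"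
      using h(2) zer_comp[OF p'(1)] Hom_obj[OF h(1)] by simp
    finally obtain u where u: "u \<in> Hom C (Cod C r) V" "u \<cdot> r = h \<cdot> q"
      using cokernel_factor[OF r c hq] by blast
    then have "(u \<cdot> d) \<cdot> q = h \<cdot> q"
      using comp_assoc[OF q'(1) d(1) u(1)] d(2) by simp
    then show ?thesis
      using cokernel_cancel[OF q comp_hom[OF d(1) u(1)] h(1)] u(1) by blast
  qed
  show "u = v" if uv: "u \<in> Hom C (Cod C r) V" "v \<in> Hom C (Cod C r) V" "u \<cdot> d = v \<cdot> d" for u v V
    using cokernel_cancel[OF r uv(1,2)] comp_assoc[OF q'(1) d(1) uv(1)]
      comp_assoc[OF q'(1) d(1) uv(2)] uv(3) d(2) by simp
qed

end

context exact_category
begin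

text \<open>Admissibility of \<open>i\<close> supplies only some cokernel \<open>e\<close> with
  \<open>(i, e) \<in> E\<close>. Closure of \<open>E\<close> under isomorphism of pairs carries this
  over to any other cokernel \<open>d\<close>, so the quotients may be chosen freely.\<close>

lemma admissible_monic_cokernel:
  assumes i: "admissible_monic E i" and d: "is_cokernel C d i"
  shows "(i, d) \<in> E"
proof -
  define A B where "A = Dom C i" and "B = Cod C i"
  have iH: "i \<in> Hom C A B"
    using d by (auto simp: is_cokernel_def Hom_def A_def B_def)
  obtain e where e: "(i, e) \<in> E" "is_kernel C i e" "is_cokernel C e i"
    using i ker_coker by (fastforce simp: admissible_monic_def kernel_cokernel_pair_def)
  note d' = cokernel_hom[OF d iH] and e' = cokernel_hom[OF e(3) iH]
  obtain a b where ab: "a \<in> Hom C (Cod C e) (Cod C d)" "b \<in> Hom C (Cod C d) (Cod C e)"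
      "a \<cdot> e = d" "b \<cdot> d = e" "isomorphism C a"
    using cokernel_unique[OF d e(3) iH] .
  have "is_kernel C i d"
    unfolding is_kernel_def
  proof (intro conjI ballI impI)
    fix h assume h: "h \<in> Arr C" "Cod C h = Dom C d \<and> d \<cdot> h = Zer C (Dom C h) (Cod C d)"
    then have hH: "h \<in> Hom C (Dom C h) B"
      using d'(1) by (simp add: Hom_def)
    \<comment> \<open>Since \<open>e = b \<cdot> d\<close>, whatever \<open>d\<close> kills is
      killed by \<open>e\<close>, and so factors through the kernel \<open>i\<close> of
      \<open>e\<close>.\<close>
    have "e \<cdot> h = Zer C (Dom C h) (Cod C e)"
      using comp_assoc[OF hH d'(1) ab(2)] h(2) ab(4) comp_zer[OF ab(2)] Hom_obj[OF hH] by simp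
    then show "\<exists>!u. u \<in> Hom C (Dom C h) (Dom C i) \<and> i \<cdot> u = h"
      using e(2) hH e'(1) by (auto simp: is_kernel_def Hom_def)
  qed (use d in \<open>auto simp: is_cokernel_def\<close>)
  then have kc: "kernel_cokernel_pair C (i, d)"
    using d by (simp add: kernel_cokernel_pair_def)
  have ob: "A \<in> Obj C" "B \<in> Obj C"
    using Hom_obj[OF iH] by auto
  \<comment> \<open>The isomorphism of pairs is the identity on \<open>A\<close> and
    \<open>B\<close> and the comparison map \<open>a\<close> on the cokernels.\<close>
  have "comm_square C i (Idn C A) (Idn C B) i"
    using comm_squareI[OF iH idn_hom idn_hom iH] ob idn_left[OF iH] idn_right[OF iH] by simp
  moreover have "comm_square C e (Idn C B) a d"
    using comm_squareI[OF e'(1) idn_hom ab(1) d'(1)] ob ab(3) idn_right[OF d'(1)] by simp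
  ultimately have "pair_iso C (i, e) (i, d)"
    using isomorphism_Idn ob ab(5) unfolding pair_iso_def by blast
  then show ?thesis
    using iso_closed[OF e(1) kc] by blast
qed

text \<open>The codomains of \<open>p\<close>, \<open>q\<close> and \<open>r\<close> stand for
  \<open>S/X\<close>, \<open>T/X\<close> and \<open>T/S\<close>, where \<open>X\<close> maps to
  \<open>T\<close> by \<open>c \<cdot> l\<close>.\<close>

lemma third_isomorphism:
  assumes l: "l \<in> Hom C X S" and c: "c \<in> Hom C S T" "admissible_monic E c"
    and p: "is_cokernel C p l" and q: "is_cokernel C q (c \<cdot> l)" and r: "is_cokernel C r c"
  obtains i d where "(i, d) \<in> E" "i \<in> Hom C (Cod C p) (Cod C q)" "d \<in> Hom C (Cod C q) (Cod C r)"
proof -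
  have cl: "c \<cdot> l \<in> Hom C X T"
    using comp_hom[OF l c(1)] .
  note q' = cokernel_hom[OF q cl] and r' = cokernel_hom[OF r c(1)]
  have "(q \<cdot> c) \<cdot> l = Zer C X (Cod C q)"
    using comp_assoc[OF l c(1) q'(1)] q'(2) by simp
  then obtain i where i: "i \<in> Hom C (Cod C p) (Cod C q)" "i \<cdot> p = q \<cdot> c"
    using cokernel_factor[OF p l comp_hom[OF c(1) q'(1)]] by blast
  have "r \<cdot> (c \<cdot> l) = Zer C X (Cod C r)"
    using comp_assoc[OF l c(1) r'(1)] r'(2) zer_comp[OF l] Hom_obj[OF r'(1)] by simp
  then obtain d where d: "d \<in> Hom C (Cod C q) (Cod C r)" "d \<cdot> q = r"
    using cokernel_factor[OF q cl r'(1)] by blast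
  have "admissible_monic E i"
    using pushout_monic[OF c(2) pushout_induced_on_cokernels[OF l c(1) p q i]] .
  then have "(i, d) \<in> E"
    using admissible_monic_cokernel cokernel_induced_on_cokernels[OF l c(1) p q r i d] by blast
  then show thesis
    using that i d by blast
qed

end

theorem lemma5p1:
  fixes C :: "('o, 'm, 'x) preadditive_scheme" and E :: "('m \<times> 'm) set"
    and Z X Y' Y'' S' S'' Q' Q'' Q :: 'o
    and x y' y'' t k' l' k'' l'' c q' q'' q :: 'm
  assumes "AIS_category C E"
    and "subobject C E Z X x" and "subobject C E Z Y' y'" and "subobject C E Z Y'' y''"
    and "t \<in> Hom C Y' Y''" and "admissible_monic E t" and "y'' \<cdot>\<^bsub>C\<^esub> t = y'"
    and "is_sum C y' x S' k' l'" and "is_sum C y'' x S'' k'' l''"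
    and "c \<in> Hom C S' S''" and "c \<cdot>\<^bsub>C\<^esub> k' = k'' \<cdot>\<^bsub>C\<^esub> t" and "c \<cdot>\<^bsub>C\<^esub> l' = l''"
    and "is_quotient C l' Q' q'" and "is_quotient C l'' Q'' q''" and "is_quotient C c Q q"
  shows "\<exists>i d. (i, d) \<in> E \<and> i \<in> Hom C Q' Q'' \<and> d \<in> Hom C Q'' Q"
proof -
  interpret AIS_category C E by fact
  note x = assms(2) and y' = assms(3) and y'' = assms(4) and t = assms(5,7)
    and s' = assms(8) and s'' = assms(9) and c = assms(10-12)
  \<comment> \<open>The map \<open>c\<close> is a projection of the pull-back of the inclusions of
    \<open>S'\<close> and \<open>S''\<close> into \<open>Z\<close>, so (AIS) makes it
    admissible.\<close>
  have "admissible_monic E c"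
    using sum_map(2)[OF x y' y'' t s' s'' c] .
  moreover have "l' \<in> Hom C X S'"
    using sum_inclusions_admissible(2)[OF y' x s'] .
  \<comment> \<open>Rewriting \<open>l''\<close> as \<open>c \<cdot> l'\<close> presents
    \<open>Q''\<close> as the quotient along the composite
    \<open>X \<rightarrow> S' \<rightarrow> S''\<close>.\<close>
  moreover have "is_cokernel C q' l'" "is_cokernel C q'' (c \<cdot>\<^bsub>C\<^esub> l')" "is_cokernel C q c"
    and "Cod C q' = Q'" "Cod C q'' = Q''" "Cod C q = Q"
    using assms(12-15) by (auto simp: is_quotient_def)
  ultimately show ?thesis
    using third_isomorphism[of l' X S' c S'' q' q'' q] c(1) by metis
qed

end
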